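(* The $R$-module $H$ is free, and $\omega_1$ and $\omega_2$ form a basis of $H$.
   Context: Let $t=(t_1,\dots,t_s)$, let $T_0,T_1,\dots,T_5\in\mathbb{C}[t]$, $R=\mathbb{C}[t,\frac1{T_0}]$, and $$f=y^2-4T_0x^3+T_1x^2+T_2x+T_3+T_4y+T_5xy\in R[x,y].$$ Let $\Omega^0=R[x,y]$ and let $\Omega^1=R[x,y]dx\oplus R[x,y]dy$ be the module of relative differential 1-forms of $R[x,y]$ over $R$ (with $d$ the relative differential). The Brieskorn module of the family $\{f=0\}$ is the $R$-module $$H=\frac{\Omega^1}{f\,\Omega^1+df\wedge\Omega^0+d\Omega^0}.$$ Put $\omega_1=\frac{-2}{5}(2x\,dy-3y\,dx)$ and $\omega_2=\frac{-2}{7}x(2x\,dy-3y\,dx)$, viewed as elements of $H$. *)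

theory Defs
  imports
    Complex_Main
    "HOL-Library.Poly_Mapping"
    "HOL-Library.Product_Plus"
    "HOL-Computational_Algebra.Polynomial"
    "HOL-Computational_Algebra.Fraction_Field"
    "HOL-Algebra.Module"
    "HOL-Algebra.AbelCoset"
begin

section \<open>Quotient modules and bases\<close>

text \<open>
  The multiplicative fields that \<^type>\<open>module\<close> records inherit from \<^type>\<open>ring\<close> records
  play no role in \<^locale>\<open>module\<close>; they are left undefined.
\<close>

definition quot_module :: "('r, 'm) module \<Rightarrow> 'm set \<Rightarrow> ('r, 'm set) module" where
  "quot_module M N =
     \<lparr>carrier = a_rcosets\<^bsub>M\<^esub> N, mult = undefined, one = undefined,
      zero = N, add = set_add M,
      smult = (\<lambda>r X. \<Union>x\<in>X. N +>\<^bsub>M\<^esub> (r \<odot>\<^bsub>M\<^esub> x))\<rparr>"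

definition module_span_by :: "('r, 'p) ring_scheme \<Rightarrow> ('r, 'm) module \<Rightarrow> 'i set \<Rightarrow> ('i \<Rightarrow> 'm) \<Rightarrow> bool" where
  "module_span_by R M I b \<longleftrightarrow>
     (\<forall>x\<in>carrier M. \<exists>J c. finite J \<and> J \<subseteq> I \<and> c \<in> J \<rightarrow> carrier R \<and>
        x = finsum M (\<lambda>i. c i \<odot>\<^bsub>M\<^esub> b i) J)"

definition module_indep :: "('r, 'p) ring_scheme \<Rightarrow> ('r, 'm) module \<Rightarrow> 'i set \<Rightarrow> ('i \<Rightarrow> 'm) \<Rightarrow> bool" where
  "module_indep R M I b \<longleftrightarrow>
     (\<forall>J c. finite J \<and> J \<subseteq> I \<and> c \<in> J \<rightarrow> carrier R \<and>
        finsum M (\<lambda>i. c i \<odot>\<^bsub>M\<^esub> b i) J = \<zero>\<^bsub>M\<^esub> \<longrightarrow> (\<forall>i\<in>J. c i = \<zero>\<^bsub>R\<^esub>))"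

definition module_basis :: "('r, 'p) ring_scheme \<Rightarrow> ('r, 'm) module \<Rightarrow> 'i set \<Rightarrow> ('i \<Rightarrow> 'm) \<Rightarrow> bool" where
  "module_basis R M I b \<longleftrightarrow>
     b \<in> I \<rightarrow> carrier M \<and> module_span_by R M I b \<and> module_indep R M I b"

definition free_module :: "('r, 'p) ring_scheme \<Rightarrow> ('r, 'm) module \<Rightarrow> bool" where
  "free_module R M \<longleftrightarrow> module R M \<and> (\<exists>B. module_basis R M B (\<lambda>x. x))"


section \<open>The base ring\<close>

text \<open>
  A polynomial in the variables \<open>t\<^sub>1, t\<^sub>2, \<dots>\<close> is a finitely supported map from exponent
  vectors to coefficients; the product on \<^type>\<open>poly_mapping\<close> is convolution.
\<close>

type_synonym cpoly = "(nat \<Rightarrow>\<^sub>0 nat) \<Rightarrow>\<^sub>0 complex"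
type_synonym cfrac = "cpoly fract"

definition cpolys :: "nat \<Rightarrow> cpoly set" where
  "cpolys s = {p. \<forall>m \<in> Poly_Mapping.keys p. Poly_Mapping.keys m \<subseteq> {1..s}}"

text \<open>
  \<open>\<complex>[t\<^sub>1, \<dots>, t\<^sub>s, 1/T\<^sub>0]\<close> as a subring of the fraction field; this is the localization at
  \<open>T\<^sub>0\<close> only when \<open>T\<^sub>0 \<noteq> 0\<close>.
\<close>

definition base_set :: "nat \<Rightarrow> cpoly \<Rightarrow> cfrac set" where
  "base_set s T0 = {Fract a (T0 ^ k) | a k. a \<in> cpolys s}"

definition base_ring :: "nat \<Rightarrow> cpoly \<Rightarrow> cfrac ring" where
  "base_ring s T0 =
     \<lparr>carrier = base_set s T0, mult = (*), one = 1, zero = 0, add = (+)\<rparr>"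


section \<open>Relative differential forms\<close>

text \<open>
  \<open>R[x,y]\<close> is realised as \<open>R[x][y]\<close>: the outer variable is \<open>y\<close>, the inner one is \<open>x\<close>.
\<close>

type_synonym xypoly = "cfrac poly poly"

definition const_xy :: "cfrac \<Rightarrow> xypoly" where
  "const_xy r = [:[:r:]:]"

definition var_x :: xypoly where
  "var_x = [:[:0, 1:]:]"

definition var_y :: xypoly where
  "var_y = [:0, 1:]"

definition deriv_x :: "xypoly \<Rightarrow> xypoly" where
  "deriv_x P = map_poly pderiv P"

definition deriv_y :: "xypoly \<Rightarrow> xypoly" where
  "deriv_y P = pderiv P"

definition Omega0 :: "nat \<Rightarrow> cpoly \<Rightarrow> xypoly set" where
  "Omega0 s T0 = {P. \<forall>i j. coeff (coeff P i) j \<in> base_set s T0}"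

text \<open>The pair \<open>(A, B)\<close> stands for the 1-form \<open>A dx + B dy\<close>.\<close>

type_synonym form1 = "xypoly \<times> xypoly"

definition form_scale :: "xypoly \<Rightarrow> form1 \<Rightarrow> form1" where
  "form_scale P \<eta> = (P * fst \<eta>, P * snd \<eta>)"

definition dd :: "xypoly \<Rightarrow> form1" where
  "dd P = (deriv_x P, deriv_y P)"

definition Omega1 :: "nat \<Rightarrow> cpoly \<Rightarrow> (cfrac, form1) module" where
  "Omega1 s T0 =
     \<lparr>carrier = Omega0 s T0 \<times> Omega0 s T0, mult = undefined, one = undefined,
      zero = 0, add = (+), smult = (\<lambda>r \<eta>. form_scale (const_xy r) \<eta>)\<rparr>"


section \<open>The family and its Brieskorn module\<close>

definition embed :: "cpoly \<Rightarrow> xypoly" where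
  "embed p = const_xy (Fract p 1)"

definition fam :: "(nat \<Rightarrow> cpoly) \<Rightarrow> xypoly" where
  "fam T = var_y^2 - 4 * embed (T 0) * var_x^3 + embed (T 1) * var_x^2 + embed (T 2) * var_x + embed (T 3)
           + embed (T 4) * var_y + embed (T 5) * var_x * var_y"

text \<open>
  For the 0-forms \<open>P\<close> occurring here, \<open>df \<and> P\<close> is the multiple \<open>P df\<close>.
\<close>

definition relations :: "nat \<Rightarrow> (nat \<Rightarrow> cpoly) \<Rightarrow> form1 set" where
  "relations s T =
     {form_scale (fam T) \<eta> + form_scale P (dd (fam T)) + dd Q | \<eta> P Q.
        \<eta> \<in> carrier (Omega1 s (T 0)) \<and> P \<in> Omega0 s (T 0) \<and> Q \<in> Omega0 s (T 0)}"

definition Brieskorn :: "nat \<Rightarrow> (nat \<Rightarrow> cpoly) \<Rightarrow> (cfrac, form1 set) module" where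
  "Brieskorn s T = quot_module (Omega1 s (T 0)) (relations s T)"

definition Brieskorn_class :: "nat \<Rightarrow> (nat \<Rightarrow> cpoly) \<Rightarrow> form1 \<Rightarrow> form1 set" where
  "Brieskorn_class s T \<eta> = relations s T +>\<^bsub>Omega1 s (T 0)\<^esub> \<eta>"

definition dX :: form1 where "dX = dd var_x"
definition dY :: form1 where "dY = dd var_y"

definition omega1 :: form1 where
  "omega1 = form_scale (const_xy (- 2 / 5)) (form_scale (2 * var_x) dY - form_scale (3 * var_y) dX)"

definition omega2 :: form1 where
  "omega2 = form_scale (const_xy (- 2 / 7) * var_x) (form_scale (2 * var_x) dY - form_scale (3 * var_y) dX)"

end

theory Submission
  imports Defs
begin

text \<open>
  Write \<open>f = y\<^sup>2 + q y - r\<close> with \<open>q, r \<in> R[x]\<close>, \<open>q = T\<^sub>4 + T\<^sub>5 x\<close> and \<open>r\<close> a cubic with leading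
  coefficient \<open>4 T\<^sub>0\<close>. The idea is to eliminate \<open>y\<close> and present \<open>H\<close> as the cokernel of a
  first-order differential operator on \<open>R[x]\<close>, which can then be computed from leading terms.

  Since \<open>f\<close> is monic in \<open>y\<close>, every form is congruent modulo \<open>f \<Omega>\<^sup>1\<close> to a unique form
  \<open>(a\<^sub>0 + a\<^sub>1 y) dx + (b\<^sub>0 + b\<^sub>1 y) dy\<close> with \<open>a\<^sub>i, b\<^sub>i \<in> R[x]\<close>. As \<open>R\<close> contains the rationals,
  the forms \<open>a(x) dx\<close> are exact, and subtracting \<open>d(b\<^sub>0 y + b\<^sub>1 y\<^sup>2/2)\<close> removes \<open>dy\<close>. What is left
  is \<open>(1/2) g(x) y dx\<close> with \<open>g = 2 a\<^sub>1 - 2 b\<^sub>0' + q b\<^sub>1'\<close>. Applied to \<open>h y df\<close> the same reduction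
  yields \<open>- (1/2) (2 w h' + 3 w' h)\<close>, where \<open>w = 4 r + q\<^sup>2\<close> is the discriminant of \<open>f\<close> as a
  quadratic polynomial in \<open>y\<close>, and all other relations yield \<open>0\<close>. So \<open>H\<close> is isomorphic to
  \<open>R[x] / D R[x]\<close> with \<open>D h = 2 w h' + 3 w' h\<close>; in the form of a membership criterion this is the
  content of \<open>linear_form_in_relI\<close> and \<open>linear_form_in_relD\<close>.

  Now \<open>w\<close> is a cubic whose leading coefficient \<open>16 T\<^sub>0\<close> is a unit, and \<open>D\<close> sends \<open>x\<^sup>k\<close> to
  \<open>16 T\<^sub>0 (2 k + 9) x\<^bsup>k+2\<^esup>\<close> plus lower terms, with a unit coefficient. Hence
  \<open>R[x] = R \<oplus> R x \<oplus> D R[x]\<close> (\<open>cubic_op_complement\<close>, \<open>cubic_op_linear_imp_zero\<close>). Finally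
  \<open>\<omega>\<^sub>1\<close> and \<open>\<omega>\<^sub>2\<close> are \<open>2 y dx\<close> and \<open>2 x y dx\<close> up to exact forms, so they correspond to \<open>4\<close> and
  \<open>4 x\<close>, a basis of the complement.
\<close>

section \<open>Quotient modules and bases\<close>

context
  fixes R :: "('r, 'p) ring_scheme" and M :: "('r, 'm) module" and N :: "'m set"
  assumes modM: "module R M" and subN: "submodule N R M"
begin

interpretation M: module R M by (rule modM)

lemma submodule_abelian_subgroup: "abelian_subgroup N M"
proof (rule abelian_subgroupI3)
  show "additive_subgroup N M"
    using subN by (simp add: additive_subgroup_def submodule_def)
qed (rule M.abelian_group_axioms)

interpretation N: abelian_subgroup N M by (rule submodule_abelian_subgroup)

lemma quot_module_carrier:
  "carrier (quot_module M N) = {N +>\<^bsub>M\<^esub> x | x. x \<in> carrier M}"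
  by (auto simp: quot_module_def A_RCOSETS_def RCOSETS_def a_r_coset_def)

lemma quot_module_zero: "\<zero>\<^bsub>quot_module M N\<^esub> = N"
  by (simp add: quot_module_def)

lemma quot_module_add:
  assumes "x \<in> carrier M" "y \<in> carrier M"
  shows "(N +>\<^bsub>M\<^esub> x) \<oplus>\<^bsub>quot_module M N\<^esub> (N +>\<^bsub>M\<^esub> y) = N +>\<^bsub>M\<^esub> (x \<oplus>\<^bsub>M\<^esub> y)"
  using assms by (simp add: quot_module_def N.a_rcos_sum)

lemma quot_module_smult:
  assumes "r \<in> carrier R" "x \<in> carrier M"
  shows "r \<odot>\<^bsub>quot_module M N\<^esub> (N +>\<^bsub>M\<^esub> x) = N +>\<^bsub>M\<^esub> (r \<odot>\<^bsub>M\<^esub> x)"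
proof -
  have eq: "N +>\<^bsub>M\<^esub> (r \<odot>\<^bsub>M\<^esub> y) = N +>\<^bsub>M\<^esub> (r \<odot>\<^bsub>M\<^esub> x)" if y: "y \<in> N +>\<^bsub>M\<^esub> x" for y
  proof -
    obtain n where n: "n \<in> N" "y = n \<oplus>\<^bsub>M\<^esub> x"
      using y by (auto simp: a_r_coset_def')
    have "n \<in> carrier M" using n(1) N.a_subset by blast
    then have "r \<odot>\<^bsub>M\<^esub> y = r \<odot>\<^bsub>M\<^esub> n \<oplus>\<^bsub>M\<^esub> r \<odot>\<^bsub>M\<^esub> x"
      using n assms by (simp add: M.smult_r_distr)
    moreover have "r \<odot>\<^bsub>M\<^esub> n \<in> N"
      using submodule.smult_closed[OF subN] assms(1) n(1) by blast
    ultimately have "r \<odot>\<^bsub>M\<^esub> y \<in> N +>\<^bsub>M\<^esub> (r \<odot>\<^bsub>M\<^esub> x)"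
      by (auto simp: a_r_coset_def')
    then show ?thesis
      using M.a_repr_independence[of "r \<odot>\<^bsub>M\<^esub> y" N "r \<odot>\<^bsub>M\<^esub> x"] assms
      by (simp add: N.a_subgroup)
  qed
  have "N +>\<^bsub>M\<^esub> x \<noteq> {}" using N.a_rcos_self assms(2) by blast
  then show ?thesis by (simp add: quot_module_def eq cong: SUP_cong)
qed

lemma coset_eq_submodule_iff:
  assumes "x \<in> carrier M"
  shows "N +>\<^bsub>M\<^esub> x = N \<longleftrightarrow> x \<in> N"
  using assms N.a_rcos_self[of x] M.a_coset_join2[of x N] N.a_subgroup by auto

lemma coset_eqI:
  assumes "x \<in> carrier M" "n \<in> N" "y = n \<oplus>\<^bsub>M\<^esub> x"
  shows "N +>\<^bsub>M\<^esub> y = N +>\<^bsub>M\<^esub> x"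
  using M.a_repr_independence[of y N x] assms N.a_subgroup by (auto simp: a_r_coset_def')

lemma module_quot_module: "module R (quot_module M N)"
proof (rule moduleI)
  show "cring R" by (rule M.is_cring)
  have N_coset: "N +>\<^bsub>M\<^esub> \<zero>\<^bsub>M\<^esub> = N"
    using coset_eq_submodule_iff N.a_subset by simp
  have cosetI: "N +>\<^bsub>M\<^esub> x \<in> carrier (quot_module M N)" if "x \<in> carrier M" for x
    using that by (auto simp: quot_module_carrier)
  have cosetE: "\<exists>x\<in>carrier M. X = N +>\<^bsub>M\<^esub> x" if "X \<in> carrier (quot_module M N)" for X
    using that by (auto simp: quot_module_carrier)
  show "abelian_group (quot_module M N)"
  proof (rule abelian_groupI)
    fix X Y Z
    assume "X \<in> carrier (quot_module M N)" "Y \<in> carrier (quot_module M N)"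
      "Z \<in> carrier (quot_module M N)"
    then obtain x y z where x: "x \<in> carrier M" "X = N +>\<^bsub>M\<^esub> x"
      and y: "y \<in> carrier M" "Y = N +>\<^bsub>M\<^esub> y" and z: "z \<in> carrier M" "Z = N +>\<^bsub>M\<^esub> z"
      using cosetE[of X] cosetE[of Y] cosetE[of Z] by auto
    show "(X \<oplus>\<^bsub>quot_module M N\<^esub> Y) \<oplus>\<^bsub>quot_module M N\<^esub> Z =
        X \<oplus>\<^bsub>quot_module M N\<^esub> (Y \<oplus>\<^bsub>quot_module M N\<^esub> Z)"
      using x y z by (simp add: quot_module_add M.a_assoc)
  next
    fix X Y
    assume "X \<in> carrier (quot_module M N)" "Y \<in> carrier (quot_module M N)"
    then obtain x y where x: "x \<in> carrier M" "X = N +>\<^bsub>M\<^esub> x"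
      and y: "y \<in> carrier M" "Y = N +>\<^bsub>M\<^esub> y"
      using cosetE[of X] cosetE[of Y] by auto
    show "X \<oplus>\<^bsub>quot_module M N\<^esub> Y \<in> carrier (quot_module M N)"
      using x y by (simp add: quot_module_add cosetI)
    show "X \<oplus>\<^bsub>quot_module M N\<^esub> Y = Y \<oplus>\<^bsub>quot_module M N\<^esub> X"
      using x y by (simp add: quot_module_add M.a_comm)
  next
    fix X
    assume "X \<in> carrier (quot_module M N)"
    then obtain x where x: "x \<in> carrier M" "X = N +>\<^bsub>M\<^esub> x" using cosetE[of X] by auto
    show "\<zero>\<^bsub>quot_module M N\<^esub> \<oplus>\<^bsub>quot_module M N\<^esub> X = X"
      using x quot_module_add[of "\<zero>\<^bsub>M\<^esub>" x] by (simp add: quot_module_zero N_coset)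
    have "(N +>\<^bsub>M\<^esub> (\<ominus>\<^bsub>M\<^esub> x)) \<oplus>\<^bsub>quot_module M N\<^esub> X = \<zero>\<^bsub>quot_module M N\<^esub>"
      using x by (simp add: quot_module_zero quot_module_add M.l_neg N_coset)
    then show "\<exists>Y\<in>carrier (quot_module M N).
        Y \<oplus>\<^bsub>quot_module M N\<^esub> X = \<zero>\<^bsub>quot_module M N\<^esub>"
      using x cosetI[of "\<ominus>\<^bsub>M\<^esub> x"] by (intro bexI) auto
  next
    show "\<zero>\<^bsub>quot_module M N\<^esub> \<in> carrier (quot_module M N)"
      using cosetI[of "\<zero>\<^bsub>M\<^esub>"] by (simp add: quot_module_zero N_coset)
  qed
qed (auto simp: quot_module_carrier quot_module_smult quot_module_add
      M.smult_l_distr M.smult_r_distr M.smult_assoc1)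

end

text \<open>
  The index sets in \<^const>\<open>module_indep\<close> range over the subsets of \<open>{i, j}\<close>; extending the
  coefficients by zero reduces them all to the full pair.
\<close>

lemma module_basis_pairI:
  fixes R :: "('r, 'p) ring_scheme" and M :: "('r, 'm) module" and i j :: 'i
  assumes modM: "module R M" and ij: "i \<noteq> j"
    and b: "b i \<in> carrier M" "b j \<in> carrier M"
    and span: "\<And>x. x \<in> carrier M \<Longrightarrow>
      \<exists>c\<in>carrier R. \<exists>d\<in>carrier R. x = c \<odot>\<^bsub>M\<^esub> b i \<oplus>\<^bsub>M\<^esub> d \<odot>\<^bsub>M\<^esub> b j"
    and indep: "\<And>c d. \<lbrakk>c \<in> carrier R; d \<in> carrier R;
      c \<odot>\<^bsub>M\<^esub> b i \<oplus>\<^bsub>M\<^esub> d \<odot>\<^bsub>M\<^esub> b j = \<zero>\<^bsub>M\<^esub>\<rbrakk> \<Longrightarrow> c = \<zero>\<^bsub>R\<^esub> \<and> d = \<zero>\<^bsub>R\<^esub>"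
  shows "module_basis R M {i, j} b"
proof -
  interpret M: module R M by (rule modM)
  have sum2: "finsum M (\<lambda>k. c k \<odot>\<^bsub>M\<^esub> b k) {i, j} = c i \<odot>\<^bsub>M\<^esub> b i \<oplus>\<^bsub>M\<^esub> c j \<odot>\<^bsub>M\<^esub> b j"
    if "c i \<in> carrier R" "c j \<in> carrier R" for c
    using that ij b by simp
  have "module_span_by R M {i, j} b"
    unfolding module_span_by_def
  proof
    fix x assume "x \<in> carrier M"
    then obtain c d where cd: "c \<in> carrier R" "d \<in> carrier R"
        "x = c \<odot>\<^bsub>M\<^esub> b i \<oplus>\<^bsub>M\<^esub> d \<odot>\<^bsub>M\<^esub> b j"
      using span by blast
    let ?c = "\<lambda>k. if k = i then c else d"
    have "x = finsum M (\<lambda>k. ?c k \<odot>\<^bsub>M\<^esub> b k) {i, j}"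
      using sum2[of ?c] cd ij by simp
    then show "\<exists>J c. finite J \<and> J \<subseteq> {i, j} \<and> c \<in> J \<rightarrow> carrier R \<and>
        x = finsum M (\<lambda>k. c k \<odot>\<^bsub>M\<^esub> b k) J"
      using cd by (intro exI[of _ "{i, j}"] exI[of _ ?c]) auto
  qed
  moreover have "module_indep R M {i, j} b"
    unfolding module_indep_def
  proof (intro allI impI ballI, elim conjE)
    fix J c k
    assume J: "finite J" "J \<subseteq> {i, j}" and c: "c \<in> J \<rightarrow> carrier R"
      and zero: "finsum M (\<lambda>k. c k \<odot>\<^bsub>M\<^esub> b k) J = \<zero>\<^bsub>M\<^esub>" and k: "k \<in> J"
    define c' where "c' k = (if k \<in> J then c k else \<zero>\<^bsub>R\<^esub>)" for k
    have c': "c' k \<in> carrier R" for k using c by (auto simp: c'_def)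
    have "finsum M (\<lambda>k. c k \<odot>\<^bsub>M\<^esub> b k) J = finsum M (\<lambda>k. c' k \<odot>\<^bsub>M\<^esub> b k) {i, j}"
      using J b c c' by (intro M.add.finprod_mono_neutral_cong_left) (auto simp: c'_def)
    then have "c' i \<odot>\<^bsub>M\<^esub> b i \<oplus>\<^bsub>M\<^esub> c' j \<odot>\<^bsub>M\<^esub> b j = \<zero>\<^bsub>M\<^esub>"
      using sum2 c' zero by simp
    then have "c' i = \<zero>\<^bsub>R\<^esub> \<and> c' j = \<zero>\<^bsub>R\<^esub>" using indep c' by blast
    then show "c k = \<zero>\<^bsub>R\<^esub>" using k J by (auto simp: c'_def)
  qed
  ultimately show ?thesis using b by (simp add: module_basis_def)
qed

lemma module_indepD:
  assumes "module_indep R M I b" "finite J" "J \<subseteq> I" "c \<in> J \<rightarrow> carrier R"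
    and "finsum M (\<lambda>i. c i \<odot>\<^bsub>M\<^esub> b i) J = \<zero>\<^bsub>M\<^esub>"
  shows "\<forall>i\<in>J. c i = \<zero>\<^bsub>R\<^esub>"
  using assms unfolding module_indep_def by blast

lemma module_basis_inj_on:
  assumes modM: "module R M" and basis: "module_basis R M I b" and nontriv: "\<one>\<^bsub>R\<^esub> \<noteq> \<zero>\<^bsub>R\<^esub>"
  shows "inj_on b I"
proof (rule inj_onI, rule ccontr)
  interpret M: module R M by (rule modM)
  fix i j assume ij: "i \<in> I" "j \<in> I" "b i = b j" "i \<noteq> j"
  have bi: "b i \<in> carrier M" using basis ij by (auto simp: module_basis_def)
  let ?c = "\<lambda>k. if k = i then \<one>\<^bsub>R\<^esub> else \<ominus>\<^bsub>R\<^esub> \<one>\<^bsub>R\<^esub>"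
  have coeffs: "?c \<in> {i, j} \<rightarrow> carrier R" by simp
  have "finsum M (\<lambda>k. ?c k \<odot>\<^bsub>M\<^esub> b k) {i, j} = \<zero>\<^bsub>M\<^esub>"
    using ij bi by (simp add: M.smult_l_minus M.M.r_neg)
  then have "\<forall>k\<in>{i, j}. ?c k = \<zero>\<^bsub>R\<^esub>"
    using basis ij coeffs by (intro module_indepD[of R M I b]) (auto simp: module_basis_def)
  then show False using nontriv by simp
qed

text \<open>
  A basis that is given as a family becomes a basis indexed by itself, as \<^const>\<open>free_module\<close>
  asks for, because an independent family over a nontrivial ring has no repetitions.
\<close>

lemma module_basis_imp_free_module:
  assumes modM: "module R M" and basis: "module_basis R M I b" and nontriv: "\<one>\<^bsub>R\<^esub> \<noteq> \<zero>\<^bsub>R\<^esub>"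
  shows "free_module R M"
proof -
  interpret M: module R M by (rule modM)
  have inj: "inj_on b I" using module_basis_inj_on assms by blast
  have bM: "b k \<in> carrier M" if "k \<in> I" for k using basis that by (auto simp: module_basis_def)
  have reindex: "finsum M (\<lambda>x. c x \<odot>\<^bsub>M\<^esub> x) (b ` J) = finsum M (\<lambda>k. c (b k) \<odot>\<^bsub>M\<^esub> b k) J"
    if "J \<subseteq> I" "c \<in> b ` J \<rightarrow> carrier R" for J c
    using that bM inj_on_subset[OF inj that(1)] by (intro M.finsum_reindex) auto
  have "module_span_by R M (b ` I) (\<lambda>x. x)"
    unfolding module_span_by_def
  proof
    fix x assume "x \<in> carrier M"
    then obtain J c where J: "finite J" "J \<subseteq> I" "c \<in> J \<rightarrow> carrier R"
        "x = finsum M (\<lambda>k. c k \<odot>\<^bsub>M\<^esub> b k) J"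
      using basis unfolding module_basis_def module_span_by_def by blast
    let ?c = "\<lambda>x. c (inv_into I b x)"
    have inv: "inv_into I b (b k) = k" if "k \<in> J" for k using inj that J by auto
    have c: "?c \<in> b ` J \<rightarrow> carrier R" using J inv by auto
    have "finsum M (\<lambda>x. ?c x \<odot>\<^bsub>M\<^esub> x) (b ` J) = finsum M (\<lambda>k. ?c (b k) \<odot>\<^bsub>M\<^esub> b k) J"
      using reindex J(2) c by blast
    also have "\<dots> = x"
      unfolding J(4) using J bM inv by (intro M.finsum_cong') auto
    finally show "\<exists>K c. finite K \<and> K \<subseteq> b ` I \<and> c \<in> K \<rightarrow> carrier R \<and>
        x = finsum M (\<lambda>x. c x \<odot>\<^bsub>M\<^esub> x) K"
      using J c by (intro exI[of _ "b ` J"] exI[of _ ?c]) auto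
  qed
  moreover have "module_indep R M (b ` I) (\<lambda>x. x)"
    unfolding module_indep_def
  proof (intro allI impI ballI, elim conjE)
    fix K c x
    assume K: "finite K" "K \<subseteq> b ` I" and c: "c \<in> K \<rightarrow> carrier R"
      and zero: "finsum M (\<lambda>x. c x \<odot>\<^bsub>M\<^esub> x) K = \<zero>\<^bsub>M\<^esub>" and x: "x \<in> K"
    obtain J where J: "J \<subseteq> I" "K = b ` J" using K(2) by (auto simp: subset_image_iff)
    have "finite J" using K(1) J inj finite_image_iff inj_on_subset by metis
    moreover have "finsum M (\<lambda>k. c (b k) \<odot>\<^bsub>M\<^esub> b k) J = \<zero>\<^bsub>M\<^esub>"
      using zero reindex[of J c] c J by simp
    moreover have "(\<lambda>k. c (b k)) \<in> J \<rightarrow> carrier R" using c J by auto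
    ultimately have "\<forall>k\<in>J. c (b k) = \<zero>\<^bsub>R\<^esub>"
      using basis J(1) unfolding module_basis_def module_indep_def by blast
    then show "c x = \<zero>\<^bsub>R\<^esub>" using x J by auto
  qed
  ultimately have "module_basis R M (b ` I) (\<lambda>x. x)"
    using bM by (auto simp: module_basis_def)
  then show ?thesis using modM by (auto simp: free_module_def)
qed

section \<open>Polynomials over a subring\<close>

definition is_subring :: "'a::comm_ring_1 set \<Rightarrow> bool" where
  "is_subring S \<longleftrightarrow> 1 \<in> S \<and> (\<forall>x\<in>S. \<forall>y\<in>S. x - y \<in> S \<and> x * y \<in> S)"

lemma is_subringD:
  assumes "is_subring S"
  shows "0 \<in> S" "1 \<in> S"
    and "x \<in> S \<Longrightarrow> - x \<in> S"
    and "\<lbrakk>x \<in> S; y \<in> S\<rbrakk> \<Longrightarrow> x + y \<in> S"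
    and "\<lbrakk>x \<in> S; y \<in> S\<rbrakk> \<Longrightarrow> x - y \<in> S"
    and "\<lbrakk>x \<in> S; y \<in> S\<rbrakk> \<Longrightarrow> x * y \<in> S"
proof -
  show one: "1 \<in> S" and diff: "\<And>x y. \<lbrakk>x \<in> S; y \<in> S\<rbrakk> \<Longrightarrow> x - y \<in> S"
    and "\<lbrakk>x \<in> S; y \<in> S\<rbrakk> \<Longrightarrow> x * y \<in> S"
    using assms by (auto simp: is_subring_def)
  show zero: "0 \<in> S" using diff[OF one one] by simp
  show neg: "\<And>x. x \<in> S \<Longrightarrow> - x \<in> S" using diff[OF zero] by simp
  show "\<lbrakk>x \<in> S; y \<in> S\<rbrakk> \<Longrightarrow> x + y \<in> S" using diff[of x "- y"] neg by simp
qed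

lemma is_subring_of_nat: "is_subring S \<Longrightarrow> of_nat n \<in> S"
  by (induction n) (auto intro: is_subringD)

lemma is_subring_numeral: "is_subring S \<Longrightarrow> numeral n \<in> S"
  using is_subring_of_nat[of S "numeral n"] by simp

lemma is_subring_power: "is_subring S \<Longrightarrow> x \<in> S \<Longrightarrow> x ^ n \<in> S"
  by (induction n) (auto intro: is_subringD)

lemma is_subring_sum:
  assumes "is_subring S" "\<And>i. i \<in> A \<Longrightarrow> g i \<in> S"
  shows "sum g A \<in> S"
  using assms(2) by (induction A rule: infinite_finite_induct) (auto intro: is_subringD[OF assms(1)])

definition polys_over :: "'a::comm_ring_1 set \<Rightarrow> 'a poly set" where
  "polys_over S = {p. \<forall>i. coeff p i \<in> S}"

lemma is_subring_polys_over:
  assumes "is_subring S"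
  shows "is_subring (polys_over S)"
  unfolding is_subring_def polys_over_def
  by (auto simp: coeff_mult intro!: is_subringD[OF assms] is_subring_sum[OF assms])

lemma pCons_in_polys_over_iff:
  "pCons a p \<in> polys_over S \<longleftrightarrow> a \<in> S \<and> p \<in> polys_over S"
proof
  assume "pCons a p \<in> polys_over S"
  then have "coeff (pCons a p) i \<in> S" for i by (simp add: polys_over_def)
  from this[of 0] this[of "Suc i" for i] show "a \<in> S \<and> p \<in> polys_over S"
    by (simp add: polys_over_def)
qed (auto simp: polys_over_def coeff_pCons split: nat.split)

lemma pderiv_in_polys_over:
  fixes p :: "'a::idom poly"
  assumes "is_subring S" "p \<in> polys_over S"
  shows "pderiv p \<in> polys_over S"
  using assms is_subring_of_nat[OF assms(1), of "Suc _"]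
  by (simp add: polys_over_def coeff_pderiv is_subringD(6) del: of_nat_Suc)

definition rational_subring :: "'k::field_char_0 set \<Rightarrow> bool" where
  "rational_subring S \<longleftrightarrow> is_subring S \<and> (\<forall>n. inverse (of_nat (Suc n)) \<in> S)"

lemma inverse_of_nat_in_rational_subring:
  assumes "rational_subring S" "n > 0"
  shows "inverse (of_nat n) \<in> S"
  using assms unfolding rational_subring_def by (metis Suc_pred)

lemma rational_multiple_in_rational_subring:
  assumes S: "rational_subring S" and x: "x \<in> S"
  shows "x / numeral b \<in> S" "x * numeral a / numeral b \<in> S" "x * (numeral a / numeral b) \<in> S"
proof -
  have ring: "is_subring S" using S by (simp add: rational_subring_def)
  have b: "inverse (numeral b) \<in> S"
    using inverse_of_nat_in_rational_subring[OF S, of "numeral b"] by simp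
  show "x / numeral b \<in> S" "x * numeral a / numeral b \<in> S" "x * (numeral a / numeral b) \<in> S"
    unfolding divide_inverse
    by (intro is_subringD(6)[OF ring] is_subring_numeral[OF ring] x b)+
qed

text \<open>
  Over a coefficient ring containing the rationals every form \<open>a(x) dx\<close> is exact.
\<close>

lemma exists_antiderivative:
  fixes p :: "'k::field_char_0 poly"
  assumes S: "rational_subring S" and p: "p \<in> polys_over S"
  shows "\<exists>P\<in>polys_over S. pderiv P = p"
proof -
  have ring: "is_subring S" using S by (simp add: rational_subring_def)
  define P where "P = (\<Sum>i\<le>degree p. monom (coeff p i * inverse (of_nat (Suc i))) (Suc i))"
  have "pderiv P = (\<Sum>i\<le>degree p. monom (coeff p i) i)"
    unfolding P_def higher_pderiv_sum[of 1, simplified] pderiv_monom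
    by (intro sum.cong) (simp_all add: field_simps del: of_nat_Suc)
  then have "pderiv P = p" by (simp add: poly_as_sum_of_monoms)
  moreover have "P \<in> polys_over S"
    unfolding P_def
    by (intro is_subring_sum[OF is_subring_polys_over[OF ring]])
      (use S p in \<open>auto simp: polys_over_def rational_subring_def coeff_monom
         intro!: is_subringD[OF ring] simp del: of_nat_Suc\<close>)
  ultimately show ?thesis by blast
qed

section \<open>The differential operator of a cubic\<close>

text \<open>
  On the curve \<open>z\<^sup>2 = w(x)\<close> one has \<open>2 d(z\<^sup>3 h) = (2 w h' + 3 w' h) z dx\<close>, so the image of the
  operator describes exact forms among the forms \<open>g(x) z dx\<close>.
\<close>

definition cubic_op :: "'k::field_char_0 poly \<Rightarrow> 'k poly \<Rightarrow> 'k poly" where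
  "cubic_op w h = 2 * w * pderiv h + 3 * pderiv w * h"

lemma cubic_op_add: "cubic_op w (g + h) = cubic_op w g + cubic_op w h"
  by (simp add: cubic_op_def pderiv_add algebra_simps)

lemma cubic_op_in_polys_over:
  assumes "is_subring S" "w \<in> polys_over S" "h \<in> polys_over S"
  shows "cubic_op w h \<in> polys_over S"
  unfolding cubic_op_def
  by (intro is_subringD is_subring_polys_over pderiv_in_polys_over is_subring_numeral assms)

lemma coeff_mult_degree_bounds:
  assumes "degree p \<le> m" "degree q \<le> n"
  shows "coeff (p * q) (m + n) = coeff p m * coeff q n"
proof (cases "degree p = m \<and> degree q = n")
  case True
  then show ?thesis using coeff_mult_degree_sum[of p q] by auto
next
  case False
  then have "degree p < m \<or> degree q < n" using assms by auto
  moreover have "degree (p * q) < m + n" 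
    using degree_mult_le[of p q] assms False by linarith
  ultimately show ?thesis by (auto simp: coeff_eq_0)
qed

text \<open>
  The two summands of \<^const>\<open>cubic_op\<close> contribute \<open>2 k\<close> and \<open>3 \<cdot> 3\<close> to the factor \<open>2 k + 9\<close>, so
  in characteristic zero there is no cancellation of leading terms.
\<close>

lemma cubic_op_leading:
  assumes w: "degree w = 3" and h: "degree h \<le> k"
  shows "degree (cubic_op w h) \<le> k + 2"
    and "coeff (cubic_op w h) (k + 2) = lead_coeff w * of_nat (2 * k + 9) * coeff h k"
proof -
  have w': "degree (pderiv w) \<le> 2" by (simp add: degree_pderiv w)
  have 1: "degree (pderiv w * h) \<le> k + 2"
    using degree_mult_le[of "pderiv w" h] w' h by linarith
  have c1: "coeff (pderiv w * h) (k + 2) = 3 * lead_coeff w * coeff h k"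
    using coeff_mult_degree_bounds[OF w' h] w
    by (simp add: coeff_pderiv eval_nat_numeral add.commute)
  have 2: "degree (w * pderiv h) \<le> k + 2 \<and>
      coeff (w * pderiv h) (k + 2) = of_nat k * lead_coeff w * coeff h k"
  proof (cases k)
    case 0
    then have "pderiv h = 0" using h by (simp add: pderiv_eq_0_iff)
    then show ?thesis using 0 by simp
  next
    case (Suc j)
    have h': "degree (pderiv h) \<le> j" using h Suc by (simp add: degree_pderiv)
    have "degree (w * pderiv h) \<le> k + 2"
      using degree_mult_le[of w "pderiv h"] w h' Suc by linarith
    moreover have "coeff (w * pderiv h) (3 + j) = coeff w 3 * coeff (pderiv h) j"
      using coeff_mult_degree_bounds[of w 3 "pderiv h" j] w h' by simp
    ultimately show ?thesis
      using Suc w by (simp add: coeff_pderiv eval_nat_numeral add.commute mult_ac)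
  qed
  have eq: "cubic_op w h =
      Polynomial.smult 2 (w * pderiv h) + Polynomial.smult 3 (pderiv w * h)"
    by (simp add: cubic_op_def numeral_mult_conv_smult mult.assoc)
  show "degree (cubic_op w h) \<le> k + 2"
    unfolding eq using 1 2
    by (intro degree_add_le) (auto intro: order.trans[OF degree_smult_le])
  show "coeff (cubic_op w h) (k + 2) = lead_coeff w * of_nat (2 * k + 9) * coeff h k"
    unfolding eq using 2 c1 by (simp add: algebra_simps)
qed

text \<open>
  A nonzero \<open>h\<close> is sent to a polynomial of degree \<open>degree h + 2 \<ge> 2\<close>, so the image meets the linear
  polynomials only in zero.
\<close>

lemma cubic_op_linear_imp_zero:
  assumes "degree w = 3" "cubic_op w h = [:c, d:]"
  shows "h = 0"
proof -
  have "coeff (cubic_op w h) (degree h + 2) = 0"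
    unfolding assms(2) by (simp add: coeff_pCons eval_nat_numeral)
  moreover have "lead_coeff w \<noteq> 0"
    using assms(1) by (metis degree_0 leading_coeff_0_iff zero_neq_numeral)
  moreover have "of_nat (2 * degree h + 9) \<noteq> (0::'a)"
    unfolding of_nat_eq_0_iff by simp
  ultimately have "lead_coeff h = 0"
    using cubic_op_leading(2)[OF assms(1) order.refl, of h] by simp
  then show ?thesis by simp
qed

text \<open>
  Division algorithm: as \<open>lead_coeff w\<close> and \<open>2 k + 9\<close> are units, a leading term of degree
  \<open>k + 2\<close> can be cancelled by the image of a multiple of \<open>x\<^sup>k\<close>, until the degree is at most one.
\<close>

lemma cubic_op_complement:
  assumes S: "rational_subring S"
    and w: "w \<in> polys_over S" "degree w = 3" "inverse (lead_coeff w) \<in> S"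
    and g: "g \<in> polys_over S"
  shows "\<exists>h\<in>polys_over S. \<exists>c\<in>S. \<exists>d\<in>S. g = cubic_op w h + [:c, d:]"
  using g
proof (induction "degree g" arbitrary: g rule: less_induct)
  case less
  have ring: "is_subring S" using S by (simp add: rational_subring_def)
  show ?case
  proof (cases "degree g \<le> 1")
    case True
    have "g = cubic_op w 0 + [:coeff g 0, coeff g 1:]"
      using True by (auto simp: poly_eq_iff cubic_op_def coeff_pCons coeff_eq_0 split: nat.split)
    moreover have "0 \<in> polys_over S" using is_subringD(1)[OF is_subring_polys_over[OF ring]] .
    moreover have "coeff g 0 \<in> S" "coeff g 1 \<in> S" using less.prems by (auto simp: polys_over_def)
    ultimately show ?thesis by blast
  next
    case False
    then obtain k where k: "degree g = k + 2" using le_Suc_ex[of 2 "degree g"] by auto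
    define a where "a = inverse (lead_coeff w) * inverse (of_nat (2 * k + 9)) * lead_coeff g"
    have u: "lead_coeff w \<noteq> 0"
      using w(2) by (metis degree_0 leading_coeff_0_iff zero_neq_numeral)
    have nz: "of_nat (2 * k + 9) \<noteq> (0::'a)" unfolding of_nat_eq_0_iff by simp
    have "inverse (of_nat (2 * k + 9)) \<in> S"
      using S unfolding rational_subring_def by (metis add_Suc_right eval_nat_numeral(3))
    then have aS: "a \<in> S"
      unfolding a_def using w(3) less.prems
      by (intro is_subringD(6)[OF ring]) (auto simp: polys_over_def)
    let ?h = "monom a k"
    have hS: "?h \<in> polys_over S"
      using aS is_subringD(1)[OF ring] by (simp add: polys_over_def coeff_monom)
    have lead: "degree (cubic_op w ?h) \<le> k + 2" "coeff (cubic_op w ?h) (k + 2) = lead_coeff g"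
      using cubic_op_leading[OF w(2) degree_monom_le, of a k] right_inverse[OF u] right_inverse[OF nz]
      by (simp_all add: a_def mult_ac del: of_nat_add of_nat_mult right_inverse left_inverse)
    let ?g = "g - cubic_op w ?h"
    have "degree ?g \<le> k + 2" using lead(1) k by (intro degree_diff_le) auto
    moreover have "coeff ?g (k + 2) = 0" using lead(2) k by simp
    ultimately have "degree ?g < degree g"
      using k eq_zero_or_degree_less[of ?g "k + 2"] by auto
    moreover have "?g \<in> polys_over S"
      using less.prems cubic_op_in_polys_over[OF ring w(1) hS]
        is_subringD(5)[OF is_subring_polys_over[OF ring]] by blast
    ultimately obtain h c d where hcd: "h \<in> polys_over S" "c \<in> S" "d \<in> S"
        "?g = cubic_op w h + [:c, d:]"
      using less.hyps by blast
    then have "g = cubic_op w (h + ?h) + [:c, d:]"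
      by (simp add: cubic_op_add algebra_simps)
    moreover have "h + ?h \<in> polys_over S"
      using hcd(1) hS is_subringD(4)[OF is_subring_polys_over[OF ring]] by blast
    ultimately show ?thesis using hcd by blast
  qed
qed

instance fract :: ("{idom, ring_char_0}") field_char_0
proof
  show "inj (of_nat :: nat \<Rightarrow> 'a fract)"
    by (auto intro!: injI simp: of_nat_fract eq_fract)
qed

section \<open>Relations between forms and elimination of \<open>y\<close>\<close>

lemma deriv_x_0: "deriv_x 0 = 0"
  by (simp add: deriv_x_def)

lemma deriv_x_pCons: "deriv_x (pCons a P) = pCons (pderiv a) (deriv_x P)"
  by (simp add: deriv_x_def map_poly_pCons)

lemma deriv_x_add: "deriv_x (P + Q) = deriv_x P + deriv_x Q"
  by (simp add: deriv_x_def poly_eq_iff coeff_map_poly pderiv_add)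

lemma deriv_x_smult:
  "deriv_x (Polynomial.smult a P) = Polynomial.smult a (deriv_x P) + Polynomial.smult (pderiv a) P"
  by (simp add: deriv_x_def poly_eq_iff coeff_map_poly pderiv_mult algebra_simps)

lemma deriv_x_mult: "deriv_x (P * Q) = P * deriv_x Q + Q * deriv_x P"
  by (induction P)
    (simp_all add: deriv_x_0 deriv_x_pCons deriv_x_add deriv_x_smult algebra_simps)

lemma dd_add: "dd (P + Q) = dd P + dd Q"
  by (simp add: dd_def deriv_x_add deriv_y_def pderiv_add)

lemma dd_mult: "dd (P * Q) = form_scale P (dd Q) + form_scale Q (dd P)"
  by (simp add: dd_def form_scale_def deriv_x_mult deriv_y_def pderiv_mult)

lemma form_scale_simps:
  "form_scale (P + Q) \<eta> = form_scale P \<eta> + form_scale Q \<eta>"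
  "form_scale P (\<eta> + \<theta>) = form_scale P \<eta> + form_scale P \<theta>"
  "form_scale (P * Q) \<eta> = form_scale P (form_scale Q \<eta>)"
  "form_scale P (form_scale Q \<eta>) = form_scale Q (form_scale P \<eta>)"
  by (simp_all add: form_scale_def algebra_simps)

text \<open>
  The setting for eliminating \<open>y\<close>: an arbitrary quadratic equation, monic in \<open>y\<close>, over \<open>R[x]\<close>.
\<close>

locale monic_quadratic =
  fixes S :: "cfrac set" and q r :: "cfrac poly"
  assumes S: "rational_subring S"
    and q: "q \<in> polys_over S" and r: "r \<in> polys_over S"
begin

definition f :: xypoly where
  "f = [:- r, q, 1:]"

text \<open>
  The discriminant of \<open>f\<close> with respect to \<open>y\<close>.
\<close>

definition w :: "cfrac poly" where
  "w = 4 * r + q ^ 2"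

definition O0 :: "xypoly set" where
  "O0 = polys_over (polys_over S)"

definition rel :: "form1 set" where
  "rel = {form_scale f \<eta> + form_scale P (dd f) + dd Q | \<eta> P Q. \<eta> \<in> O0 \<times> O0 \<and> P \<in> O0 \<and> Q \<in> O0}"

lemma ring: "is_subring S" "is_subring (polys_over S)" "is_subring O0"
  using S by (simp_all add: rational_subring_def O0_def is_subring_polys_over)

lemma pCons_O0_iff: "pCons a P \<in> O0 \<longleftrightarrow> a \<in> polys_over S \<and> P \<in> O0"
  by (simp add: O0_def pCons_in_polys_over_iff)

lemmas ringI = is_subringD[OF ring(1)] is_subringD[OF ring(2)] is_subringD[OF ring(3)]
  is_subring_numeral[OF ring(1)] is_subring_numeral[OF ring(2)] is_subring_numeral[OF ring(3)]
  pderiv_in_polys_over[OF ring(1)] is_subring_power[OF ring(2)]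

lemma relI:
  assumes "\<theta> \<in> O0 \<times> O0" "P \<in> O0" "Q \<in> O0"
    and "\<eta> = form_scale f \<theta> + form_scale P (dd f) + dd Q"
  shows "\<eta> \<in> rel"
  unfolding rel_def using assms by blast

lemma f_O0: "f \<in> O0"
  using q r by (simp add: f_def pCons_O0_iff ringI)

lemma w_over: "w \<in> polys_over S"
  unfolding w_def by (intro ringI q r)

lemma dd_f: "dd f = ([:- pderiv r, pderiv q:], [:q, 2:])"
  by (simp add: f_def dd_def deriv_x_pCons deriv_x_0 deriv_y_def pderiv_pCons pderiv_minus)

lemma dd_linear: "dd [:a, b:] = ([:pderiv a, pderiv b:], [:b:])"
  by (simp add: dd_def deriv_x_pCons deriv_x_0 deriv_y_def pderiv_pCons)

text \<open>
  Division by the monic polynomial \<open>f\<close>, which keeps the coefficients in the subring.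
\<close>

lemma division:
  assumes "P \<in> O0"
  obtains V a b where "V \<in> O0" "a \<in> polys_over S" "b \<in> polys_over S" "P = f * V + [:a, b:]"
proof -
  have "\<exists>V\<in>O0. \<exists>a\<in>polys_over S. \<exists>b\<in>polys_over S. P = f * V + [:a, b:]"
    using assms
  proof (induction P)
    case 0
    show ?case by (rule bexI[of _ 0], rule bexI[of _ 0], rule bexI[of _ 0]) (auto intro: ringI)
  next
    case (pCons c P)
    then obtain V a b where V: "V \<in> O0" "a \<in> polys_over S" "b \<in> polys_over S"
        "P = f * V + [:a, b:]" and c: "c \<in> polys_over S"
      by (auto simp: pCons_O0_iff)
    have "pCons c P = f * pCons b V + [:c + b * r, a - b * q:]"
      by (simp add: V(4) f_def algebra_simps)
    moreover have "pCons b V \<in> O0" "c + b * r \<in> polys_over S" "a - b * q \<in> polys_over S"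
      using V c q r by (auto simp: pCons_O0_iff intro: ringI)
    ultimately show ?case by blast
  qed
  then show ?thesis using that by blast
qed

lemma division_unique:
  assumes "f * V + [:a, b:] = f * V' + [:a', b':]"
  shows "a = a'" "b = b'"
proof -
  have eq: "f * (V - V') = [:a' - a, b' - b:]" 
  proof -
    have "A - B = D - C" if "A + C = B + D" for A B C D :: xypoly
      using that by (simp add: algebra_simps)
    from this[OF assms] have "f * V - f * V' = [:a', b':] - [:a, b:]" .
    then show ?thesis by (simp add: right_diff_distrib)
  qed
  have "V - V' = 0"
  proof (rule ccontr)
    assume nz: "V - V' \<noteq> 0"
    have "degree f = 2" "f \<noteq> 0" by (simp_all add: f_def)
    then have "degree (f * (V - V')) \<ge> 2" using nz by (simp add: degree_mult_eq)
    moreover have "degree [:a' - a, b' - b:] \<le> 1" by (simp add: degree_pCons_le)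
    ultimately show False using eq by simp
  qed
  then show "a = a'" "b = b'" using eq by simp_all
qed

text \<open>
  Twice the coefficient of \<open>y dx\<close> that is left of \<open>(a\<^sub>0 + a\<^sub>1 y) dx + (b\<^sub>0 + b\<^sub>1 y) dy\<close> in \<open>H\<close>:
  modulo exact forms, \<open>b\<^sub>0 dy\<close> becomes \<open>- b\<^sub>0' y dx\<close> and \<open>b\<^sub>1 y dy\<close> becomes \<open>- (1/2) b\<^sub>1' y\<^sup>2 dx\<close>,
  where \<open>y\<^sup>2 = r - q y\<close>; forms \<open>a(x) dx\<close> are exact.
\<close>

definition reduced :: "cfrac poly \<Rightarrow> cfrac poly \<Rightarrow> cfrac poly \<Rightarrow> cfrac poly" where
  "reduced a1 b0 b1 = 2 * a1 - 2 * pderiv b0 + q * pderiv b1"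

text \<open>
  The form \<open>- 2 h y df\<close> reduces to \<^term>\<open>cubic_op w h\<close>. What remains after subtracting it reduces
  to zero, hence is the differential of some \<open>c\<^sub>0 + c\<^sub>1 y + c\<^sub>2 y\<^sup>2\<close> up to a multiple of \<open>f\<close>.
\<close>

lemma linear_form_in_relI:
  assumes over: "a0 \<in> polys_over S" "a1 \<in> polys_over S" "b0 \<in> polys_over S" "b1 \<in> polys_over S"
    and h: "h \<in> polys_over S" and eq: "reduced a1 b0 b1 = cubic_op w h"
  shows "([:a0, a1:], [:b0, b1:]) \<in> rel"
proof -
  have "inverse (of_nat (Suc 1)) \<in> S" using S unfolding rational_subring_def by blast
  then have half: "[:1 / 2:] \<in> polys_over S"
    by (simp add: pCons_in_polys_over_iff ringI inverse_eq_divide)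
  \<comment> \<open>The coefficients \<open>c\<^sub>1, c\<^sub>2\<close> are forced by the \<open>dy\<close>-part, and the multiple \<open>e\<close> of \<open>f\<close> by the \<open>y\<^sup>2 dx\<close>-term.\<close>
  define c2 where "c2 = [:1 / 2:] * b1 - h * q"
  have c2: "c2 \<in> polys_over S" unfolding c2_def by (intro ringI half over h q)
  have "2 * ([:1 / 2:] * b1) = b1"
    by (simp add: numeral_poly mult.assoc[symmetric])
  then have b1: "b1 = 2 * c2 + 2 * h * q" by (simp add: c2_def algebra_simps)
  define e where "e = 2 * h * pderiv q - pderiv c2"
  have e: "e \<in> polys_over S" unfolding e_def by (intro ringI h q c2)
  obtain c0 where c0: "c0 \<in> polys_over S" "pderiv c0 = a0 + r * e"
    using exists_antiderivative[OF S, of "a0 + r * e"] over r e by (auto intro: ringI)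
  define c1 where "c1 = b0 + 4 * r * h"
  have c1: "c1 \<in> polys_over S" unfolding c1_def by (intro ringI over r h)
  have "2 * a1 = 2 * pderiv b0 - q * pderiv b1 + cubic_op w h"
    using eq by (simp add: reduced_def algebra_simps)
  also have "\<dots> = 2 * (q * e + 2 * h * pderiv r + pderiv c1)"
    by (simp add: b1 cubic_op_def w_def e_def c1_def pderiv_add pderiv_mult power2_eq_square algebra_simps)
  finally have a1: "a1 = q * e + 2 * h * pderiv r + pderiv c1"
    by (metis mult_cancel_left zero_neq_numeral)
  let ?P = "[:0, - 2 * h:]" and ?Q = "[:c0, c1, c2:]"
  have "([:a0, a1:], [:b0, b1:]) = form_scale f ([:e:], [:4 * h:]) + form_scale ?P (dd f) + dd ?Q"
    by (simp add: form_scale_def dd_f) 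
      (simp add: f_def dd_def deriv_x_pCons deriv_x_0 deriv_y_def pderiv_pCons c0 a1 b1 c1_def
        e_def algebra_simps)
  moreover have "?P \<in> O0" "?Q \<in> O0" "([:e:], [:4 * h:]) \<in> O0 \<times> O0"
    using h e c0 c1 c2 by (auto simp: pCons_O0_iff intro!: ringI)
  ultimately show ?thesis unfolding rel_def by blast
qed

text \<open>
  Because \<open>d(f W) = f dW + W df\<close>, remainders modulo \<open>f\<close> may be taken of both \<open>P\<close> and \<open>Q\<close> in a
  relation \<open>f \<eta> + P df + dQ\<close> at the expense of changing \<open>\<eta>\<close>. So every relation has the shape
  \<open>f \<eta> + (s\<^sub>0 + s\<^sub>1 y) df + d(c\<^sub>0 + c\<^sub>1 y)\<close>, and uniqueness of remainders determines its linear
  form.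
\<close>

lemma linear_form_in_relD:
  assumes "([:a0, a1:], [:b0, b1:]) \<in> rel"
  shows "\<exists>h. reduced a1 b0 b1 = cubic_op w h"
proof -
  obtain E1 E2 P Q where O0: "E1 \<in> O0" "E2 \<in> O0" "P \<in> O0" "Q \<in> O0"
    and eq: "([:a0, a1:], [:b0, b1:]) = form_scale f (E1, E2) + form_scale P (dd f) + dd Q"
    using assms by (auto simp: rel_def)
  obtain W c0 c1 where W: "W \<in> O0" "Q = f * W + [:c0, c1:]"
    using division[OF O0(4)] by blast
  have "P + W \<in> O0" using O0(3) W(1) by (rule ringI)
  then obtain V s0 s1 where V: "P + W = f * V + [:s0, s1:]"
    using division by blast
  have "form_scale P (dd f) + dd Q =
      form_scale f (dd W) + form_scale (P + W) (dd f) + dd [:c0, c1:]"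
    by (simp add: W(2) dd_add dd_mult form_scale_simps algebra_simps)
  then have eq': "([:a0, a1:], [:b0, b1:]) =
      form_scale f ((E1, E2) + dd W + form_scale V (dd f)) + form_scale [:s0, s1:] (dd f) + dd [:c0, c1:]"
    using eq by (simp add: V form_scale_simps algebra_simps)
  obtain F1 F2 where F: "(E1, E2) + dd W + form_scale V (dd f) = (F1, F2)" by (rule prod.exhaust)
  have A: "[:a0, a1:] = f * F1 + ([:s0, s1:] * [:- pderiv r, pderiv q:] + [:pderiv c0, pderiv c1:])"
    and B: "[:b0, b1:] = f * F2 + ([:s0, s1:] * [:q, 2:] + [:c1:])"
    using eq' unfolding F by (simp_all add: form_scale_def dd_f dd_linear add.assoc del: mult_pCons_left mult_pCons_right)
  have "[:s0, s1:] * [:- pderiv r, pderiv q:] + [:pderiv c0, pderiv c1:] = f * [:s1 * pderiv q:] +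
      [:- s0 * pderiv r + s1 * pderiv q * r + pderiv c0,
        s0 * pderiv q - s1 * pderiv r - s1 * pderiv q * q + pderiv c1:]"
    by (simp add: f_def algebra_simps)
  with A have "f * 0 + [:a0, a1:] = f * (F1 + [:s1 * pderiv q:]) +
      [:- s0 * pderiv r + s1 * pderiv q * r + pderiv c0,
        s0 * pderiv q - s1 * pderiv r - s1 * pderiv q * q + pderiv c1:]"
    by (simp only: mult_zero_right add_0 distrib_left add.assoc)
  from division_unique(2)[OF this]
  have a1: "a1 = s0 * pderiv q - s1 * pderiv r - s1 * pderiv q * q + pderiv c1" .
  have "[:s0, s1:] * [:q, 2:] + [:c1:] = f * [:2 * s1:] + [:s0 * q + 2 * s1 * r + c1, 2 * s0 - s1 * q:]"
    by (simp add: f_def algebra_simps)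
  with B have "f * 0 + [:b0, b1:] = f * (F2 + [:2 * s1:]) +
      [:s0 * q + 2 * s1 * r + c1, 2 * s0 - s1 * q:]"
    by (simp only: mult_zero_right add_0 distrib_left add.assoc)
  from division_unique[OF this]
  have b: "b0 = s0 * q + 2 * s1 * r + c1" "b1 = 2 * s0 - s1 * q" .
  \<comment> \<open>The contributions of \<open>s\<^sub>0\<close>, \<open>c\<^sub>0\<close> and \<open>c\<^sub>1\<close> cancel.\<close>
  have "2 * reduced a1 b0 b1 = - cubic_op w s1"
    by (simp add: reduced_def a1 b cubic_op_def w_def pderiv_add pderiv_diff pderiv_mult power2_eq_square
        algebra_simps)
  also have "\<dots> = 2 * cubic_op w ([:- 1 / 2:] * s1)"
    by (simp add: cubic_op_def pderiv_smult pderiv_minus numeral_poly smult_diff_right)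
  finally show ?thesis by auto
qed

text \<open>
  A multiplier \<open>c\<close> with \<open>dc = 0\<close> commutes with \<open>d\<close>, so it preserves the exact summand \<open>dQ\<close>.
\<close>

lemma rel_smult:
  assumes "\<eta> \<in> rel" "c \<in> O0" "dd c = 0"
  shows "form_scale c \<eta> \<in> rel"
proof -
  obtain \<theta> P Q where \<theta>: "\<theta> \<in> O0 \<times> O0" "P \<in> O0" "Q \<in> O0"
      "\<eta> = form_scale f \<theta> + form_scale P (dd f) + dd Q"
    using assms(1) by (auto simp: rel_def)
  have "form_scale c \<eta> = form_scale f (form_scale c \<theta>) + form_scale (c * P) (dd f) + dd (c * Q)"
    unfolding \<theta>(4) dd_mult assms(3) by (simp add: form_scale_def algebra_simps)
  moreover have "form_scale c \<theta> \<in> O0 \<times> O0" "c * P \<in> O0" "c * Q \<in> O0"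
    using \<theta> assms(2) by (auto simp: form_scale_def intro: ringI)
  ultimately show ?thesis by (intro relI)
qed

lemma rel_add:
  assumes "\<eta> \<in> rel" "\<eta>' \<in> rel"
  shows "\<eta> + \<eta>' \<in> rel"
proof -
  obtain \<theta> P Q where \<theta>: "\<theta> \<in> O0 \<times> O0" "P \<in> O0" "Q \<in> O0"
      "\<eta> = form_scale f \<theta> + form_scale P (dd f) + dd Q"
    using assms(1) by (auto simp: rel_def)
  obtain \<theta>' P' Q' where \<theta>': "\<theta>' \<in> O0 \<times> O0" "P' \<in> O0" "Q' \<in> O0"
      "\<eta>' = form_scale f \<theta>' + form_scale P' (dd f) + dd Q'"
    using assms(2) by (auto simp: rel_def)
  have "\<eta> + \<eta>' = form_scale f (\<theta> + \<theta>') + form_scale (P + P') (dd f) + dd (Q + Q')"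
    unfolding \<theta>(4) \<theta>'(4) by (simp add: form_scale_simps dd_add algebra_simps)
  moreover have "\<theta> + \<theta>' \<in> O0 \<times> O0" "P + P' \<in> O0" "Q + Q' \<in> O0"
    using \<theta> \<theta>' by (auto intro!: ringI)
  ultimately show ?thesis by (intro relI)
qed

lemma rel_multiple:
  assumes "\<eta> \<in> O0 \<times> O0"
  shows "form_scale f \<eta> \<in> rel"
proof -
  have "form_scale f \<eta> = form_scale f \<eta> + form_scale 0 (dd f) + dd 0"
    by (simp add: form_scale_def dd_def deriv_x_0 deriv_y_def zero_prod_def)
  then show ?thesis unfolding rel_def using assms ringI(13) by blast
qed

lemma omega_combination:
  "form_scale (const_xy c) omega1 + form_scale (const_xy d) omega2 =
     ([:0, [:c * (6 / 5), d * (6 / 7):]:], [:[:0, - c * (4 / 5), - d * (4 / 7):], 0:])"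
  by (simp add: omega1_def omega2_def dX_def dY_def dd_def deriv_x_def deriv_y_def
      form_scale_def const_xy_def var_x_def var_y_def numeral_poly map_poly_pCons pderiv_pCons)

lemma reduced_omega_combination:
  "reduced [:c * (6 / 5), d * (6 / 7):] [:0, - c * (4 / 5), - d * (4 / 7):] 0 = [:4 * c, 4 * d:]"
  by (simp add: reduced_def pderiv_pCons numeral_poly algebra_simps)

end

section \<open>Generation and independence of the two classes\<close>

context monic_quadratic
begin

lemma reduced_diff:
  "reduced (a1 - a1') (b0 - b0') (b1 - b1') = reduced a1 b0 b1 - reduced a1' b0' b1'"
  by (simp add: reduced_def pderiv_diff algebra_simps)

lemma dd_in_forms:
  assumes "P \<in> O0"
  shows "dd P \<in> O0 \<times> O0"
proof -
  have "deriv_x P \<in> O0"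
    using assms pderiv_in_polys_over[OF ring(1)]
    unfolding O0_def polys_over_def[of "polys_over S"] by (simp add: deriv_x_def coeff_map_poly)
  moreover have "deriv_y P \<in> O0"
    using assms pderiv_in_polys_over[OF ring(2)] by (simp add: O0_def deriv_y_def)
  ultimately show ?thesis by (simp add: dd_def)
qed

lemma rel_subset: "rel \<subseteq> O0 \<times> O0"
proof
  fix \<eta> assume "\<eta> \<in> rel"
  then obtain \<theta> P Q where "\<theta> \<in> O0 \<times> O0" "P \<in> O0" "Q \<in> O0"
      "\<eta> = form_scale f \<theta> + form_scale P (dd f) + dd Q"
    by (auto simp: rel_def)
  then show "\<eta> \<in> O0 \<times> O0"
    using dd_in_forms f_O0 dd_in_forms[OF f_O0]
    by (auto simp: form_scale_def mem_Times_iff intro!: ringI)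
qed

lemma omega_combination_in_forms:
  assumes "c \<in> S" "d \<in> S"
  shows "form_scale (const_xy c) omega1 + form_scale (const_xy d) omega2 \<in> O0 \<times> O0"
  unfolding omega_combination using assms
  by (auto simp: pCons_O0_iff pCons_in_polys_over_iff
      intro: ringI rational_multiple_in_rational_subring[OF S])

text \<open>
  The reduction of the form is split as \<open>D h + c' + d' x\<close>; since \<open>c \<omega>\<^sub>1 + d \<omega>\<^sub>2\<close> reduces to
  \<open>4 c + 4 d x\<close>, the coefficients are \<open>c' / 4\<close> and \<open>d' / 4\<close>.
\<close>

lemma omega_span:
  assumes w: "degree w = 3" "inverse (lead_coeff w) \<in> S" and \<eta>: "\<eta> \<in> O0 \<times> O0"
  shows "\<exists>c\<in>S. \<exists>d\<in>S.
    \<eta> - (form_scale (const_xy c) omega1 + form_scale (const_xy d) omega2) \<in> rel"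
proof -
  obtain A B where AB: "\<eta> = (A, B)" "A \<in> O0" "B \<in> O0" using \<eta> by auto
  obtain V a0 a1 where V: "V \<in> O0" "a0 \<in> polys_over S" "a1 \<in> polys_over S" "A = f * V + [:a0, a1:]"
    using division[OF AB(2)] by blast
  obtain V' b0 b1 where V': "V' \<in> O0" "b0 \<in> polys_over S" "b1 \<in> polys_over S" "B = f * V' + [:b0, b1:]"
    using division[OF AB(3)] by blast
  have "reduced a1 b0 b1 \<in> polys_over S" unfolding reduced_def by (intro ringI V V' q)
  then obtain h c' d' where h: "h \<in> polys_over S" "c' \<in> S" "d' \<in> S"
      "reduced a1 b0 b1 = cubic_op w h + [:c', d':]"
    using cubic_op_complement[OF S w_over w] by blast
  define c d where "c = c' / 4" and "d = d' / 4"
  have cd: "c \<in> S" "d \<in> S"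
    unfolding c_def d_def using h by (auto intro: rational_multiple_in_rational_subring[OF S])
  let ?a = "[:c * (6 / 5), d * (6 / 7):]" and ?b = "[:0, - c * (4 / 5), - d * (4 / 7):]"
  have over: "?a \<in> polys_over S" "?b \<in> polys_over S"
    using cd by (auto simp: pCons_in_polys_over_iff
        intro: ringI rational_multiple_in_rational_subring[OF S])
  have eq: "reduced (a1 - ?a) (b0 - ?b) (b1 - 0) = cubic_op w h"
    unfolding reduced_diff reduced_omega_combination h(4) by (simp add: c_def d_def)
  have "([:a0, a1 - ?a:], [:b0 - ?b, b1 - 0:]) \<in> rel"
    by (rule linear_form_in_relI[OF _ _ _ _ h(1) eq])
      (use V(2,3) V'(2,3) over in \<open>simp_all only: ringI diff_zero\<close>)
  then have "form_scale f (V, V') + ([:a0, a1 - ?a:], [:b0 - ?b, b1 - 0:]) \<in> rel"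
    using V V' by (intro rel_add rel_multiple) auto
  also have "form_scale f (V, V') + ([:a0, a1 - ?a:], [:b0 - ?b, b1 - 0:]) =
      \<eta> - (form_scale (const_xy c) omega1 + form_scale (const_xy d) omega2)"
    unfolding omega_combination unfolding AB(1) V(4) V'(4)
    by (simp add: form_scale_def add_diff_eq[symmetric])
  finally show ?thesis using cd by blast
qed

lemma omega_independent:
  assumes w: "degree w = 3"
    and rel: "form_scale (const_xy c) omega1 + form_scale (const_xy d) omega2 \<in> rel"
  shows "c = 0 \<and> d = 0"
proof -
  let ?a = "[:c * (6 / 5), d * (6 / 7):]" and ?b = "[:0, - c * (4 / 5), - d * (4 / 7):]"
  have "([:0, ?a:], [:?b, 0:]) \<in> rel" using rel by (simp only: omega_combination)
  then obtain h where h: "reduced ?a ?b 0 = cubic_op w h" using linear_form_in_relD by blast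
  then have eq: "cubic_op w h = [:4 * c, 4 * d:]" by (simp only: reduced_omega_combination)
  then have "h = 0" by (rule cubic_op_linear_imp_zero[OF w])
  then show ?thesis using eq by (simp add: cubic_op_def)
qed

end

section \<open>The base ring\<close>

lemma is_subring_cpolys: "is_subring (cpolys s)"
proof -
  have "x * y \<in> cpolys s" if "x \<in> cpolys s" "y \<in> cpolys s" for x y
    unfolding cpolys_def
  proof (intro CollectI ballI)
    fix m assume "m \<in> Poly_Mapping.keys (x * y)"
    then obtain a b where m: "m = a + b" "a \<in> Poly_Mapping.keys x" "b \<in> Poly_Mapping.keys y"
      using keys_mult[of x y] by blast
    then have "Poly_Mapping.keys a \<union> Poly_Mapping.keys b \<subseteq> {1..s}"
      using that by (auto simp: cpolys_def)
    then show "Poly_Mapping.keys m \<subseteq> {1..s}" using keys_add[of a b] m(1) by blast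
  qed
  moreover have "x - y \<in> cpolys s" if "x \<in> cpolys s" "y \<in> cpolys s" for x y
    using that keys_diff[of x y] by (fastforce simp: cpolys_def)
  moreover have "1 \<in> cpolys s" by (simp add: cpolys_def)
  ultimately show ?thesis by (simp add: is_subring_def)
qed

lemma base_setI: "a \<in> cpolys s \<Longrightarrow> Fract a (T0 ^ k) \<in> base_set s T0"
  by (auto simp: base_set_def)

lemma rational_subring_base_set:
  assumes T0: "T0 \<in> cpolys s" "T0 \<noteq> 0"
  shows "rational_subring (base_set s T0)"
  unfolding rational_subring_def
proof
  note cpolysI = is_subringD[OF is_subring_cpolys[of s]] is_subring_power[OF is_subring_cpolys[of s]]
  have "1 \<in> base_set s T0"
    using base_setI[of 1 s T0 0] cpolysI(2) by (simp add: One_fract_def)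
  moreover have "x - y \<in> base_set s T0 \<and> x * y \<in> base_set s T0"
    if xy: "x \<in> base_set s T0" "y \<in> base_set s T0" for x y
  proof -
    obtain a k b l where a: "a \<in> cpolys s" "x = Fract a (T0 ^ k)"
      and b: "b \<in> cpolys s" "y = Fract b (T0 ^ l)"
      using xy by (auto simp: base_set_def)
    have "x - y = Fract (a * T0 ^ l - b * T0 ^ k) (T0 ^ (k + l))"
      using T0 a b by (simp add: power_add)
    moreover have "x * y = Fract (a * b) (T0 ^ (k + l))"
      using a b by (simp add: power_add)
    ultimately show ?thesis using T0 a b by (auto intro!: base_setI cpolysI)
  qed
  ultimately show "is_subring (base_set s T0)" by (simp add: is_subring_def)
  show "\<forall>n. inverse (of_nat (Suc n)) \<in> base_set s T0"
  proof
    fix n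
    define c :: cpoly where "c = Poly_Mapping.single 0 (1 / of_nat (Suc n))"
    have "of_nat (Suc n) = (Poly_Mapping.single 0 (of_nat (Suc n)) :: cpoly)"
      by (rule single_of_nat[symmetric])
    then have "c * of_nat (Suc n) = Poly_Mapping.single 0 (1 / of_nat (Suc n) * of_nat (Suc n))"
      by (simp only: c_def mult_single add_0)
    also have "1 / of_nat (Suc n) * of_nat (Suc n) = (1::complex)"
      by (simp del: of_nat_Suc)
    finally have "c * of_nat (Suc n) = 1" by simp
    then have "Fract c 1 * of_nat (Suc n) = 1"
      by (simp add: of_nat_fract One_fract_def del: of_nat_Suc)
    then have "inverse (of_nat (Suc n)) = Fract c 1"
      by (metis inverse_unique mult.commute)
    moreover have "c \<in> cpolys s" by (simp add: c_def cpolys_def)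
    ultimately show "inverse (of_nat (Suc n)) \<in> base_set s T0"
      using base_setI[of c s T0 0] by simp
  qed
qed

lemma cring_base_ring:
  assumes "is_subring (base_set s T0)"
  shows "cring (base_ring s T0)"
proof (rule cringI)
  show "abelian_group (base_ring s T0)"
    by (rule abelian_groupI)
      (auto simp: base_ring_def algebra_simps intro: is_subringD[OF assms] bexI[of _ "- _"])
  show "comm_monoid (base_ring s T0)"
    by (rule comm_monoidI) (auto simp: base_ring_def algebra_simps intro: is_subringD[OF assms])
qed (auto simp: base_ring_def algebra_simps)

lemma Omega0_eq_polys_over: "Omega0 s T0 = polys_over (polys_over (base_set s T0))"
  by (auto simp: Omega0_def polys_over_def)

lemma const_xy_hom:
  "const_xy (a + b) = const_xy a + const_xy b"
  "const_xy (a * b) = const_xy a * const_xy b"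
  "const_xy 1 = 1" "const_xy 0 = 0" "const_xy (- a) = - const_xy a"
  by (simp_all add: const_xy_def one_pCons)

lemma module_Omega1:
  assumes S: "is_subring (base_set s T0)"
  shows "module (base_ring s T0) (Omega1 s T0)"
proof (rule moduleI)
  note Om = is_subringD[OF is_subring_polys_over[OF is_subring_polys_over[OF S]], folded Omega0_eq_polys_over]
  show "cring (base_ring s T0)" using S by (rule cring_base_ring)
  show "abelian_group (Omega1 s T0)"
  proof (rule abelian_groupI)
    fix x assume "x \<in> carrier (Omega1 s T0)"
    then show "\<exists>y\<in>carrier (Omega1 s T0). y \<oplus>\<^bsub>Omega1 s T0\<^esub> x = \<zero>\<^bsub>Omega1 s T0\<^esub>"
      by (intro bexI[of _ "- x"]) (auto simp: Omega1_def intro: Om)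
  qed (auto simp: Omega1_def algebra_simps zero_prod_def intro: Om)
  fix a x assume "a \<in> carrier (base_ring s T0)" "x \<in> carrier (Omega1 s T0)"
  moreover from this have "const_xy a \<in> Omega0 s T0"
    using is_subringD(1)[OF S] is_subringD(1)[OF is_subring_polys_over[OF S]] Om(1)
    by (simp add: const_xy_def Omega0_eq_polys_over pCons_in_polys_over_iff base_ring_def)
  ultimately show "a \<odot>\<^bsub>Omega1 s T0\<^esub> x \<in> carrier (Omega1 s T0)"
    by (auto simp: Omega1_def form_scale_def intro: Om)
qed (auto simp: Omega1_def base_ring_def form_scale_def const_xy_hom algebra_simps)

section \<open>The basis of the Brieskorn module\<close>

theorem proposition5:
  fixes s :: nat and T :: "nat \<Rightarrow> cpoly"
  assumes "\<And>i. i \<le> 5 \<Longrightarrow> T i \<in> cpolys s"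
    and "T 0 \<noteq> 0"
  shows "free_module (base_ring s (T 0)) (Brieskorn s T)
    \<and> module_basis (base_ring s (T 0)) (Brieskorn s T) {1, 2 :: nat}
        (\<lambda>i. Brieskorn_class s T (if i = 1 then omega1 else omega2))"
proof -
  let ?S = "base_set s (T 0)" and ?R = "base_ring s (T 0)" and ?M = "Omega1 s (T 0)"
    and ?N = "relations s T"
  define t where "t i = Fract (T i) 1" for i
  have S: "rational_subring ?S" using rational_subring_base_set assms by simp
  then have ringS: "is_subring ?S" by (simp add: rational_subring_def)
  have t: "t i \<in> ?S" if "i \<le> 5" for i
    using base_setI[OF assms(1)[OF that], of "T 0" 0] by (simp add: t_def)
  define q r where "q = [:t 4, t 5:]" and "r = [:- t 3, - t 2, - t 1, 4 * t 0:]"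
  interpret W: monic_quadratic ?S q r
    by standard
      (use t in \<open>auto simp: S q_def r_def pCons_in_polys_over_iff
        intro!: is_subringD[OF ringS] is_subringD[OF is_subring_polys_over[OF ringS]]
          is_subring_numeral[OF ringS]\<close>)
  have fam: "fam T = W.f"
  proof -
    have "embed (T i) = [:[:t i:]:]" for i by (simp add: embed_def const_xy_def t_def)
    then show ?thesis
      unfolding fam_def W.f_def unfolding q_def r_def
      by (simp add: var_x_def var_y_def numeral_poly power2_eq_square power3_eq_cube)
  qed
  have O0: "W.O0 = Omega0 s (T 0)" by (simp add: W.O0_def Omega0_eq_polys_over)
  have N: "?N = W.rel"
    by (simp add: relations_def W.rel_def fam O0 Omega1_def)
  have t0: "t 0 \<noteq> 0" using assms(2) by (simp add: t_def Zero_fract_def eq_fract)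
  have "W.w = [:t 4 ^ 2 - 4 * t 3, 2 * t 4 * t 5 - 4 * t 2, t 5 ^ 2 - 4 * t 1, 16 * t 0:]"
    unfolding W.w_def unfolding q_def r_def
    by (simp add: numeral_poly power2_eq_square algebra_simps)
  then have w: "degree W.w = 3" "lead_coeff W.w = 16 * t 0" using t0 by simp_all
  have "inverse (t 0) = Fract 1 (T 0 ^ 1)" using assms(2) by (simp add: t_def)
  then have "inverse (t 0) \<in> ?S"
    using base_setI[of 1 s "T 0" 1] is_subringD(2)[OF is_subring_cpolys[of s]] by simp
  moreover have "inverse 16 \<in> ?S"
    using inverse_of_nat_in_rational_subring[OF S, of 16] by simp
  ultimately have w_unit: "inverse (lead_coeff W.w) \<in> ?S"
    unfolding w(2) inverse_mult_distrib by (intro is_subringD(6)[OF ringS])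

  have modM: "module ?R ?M" using ringS by (rule module_Omega1)
  interpret M: module ?R ?M by (rule modM)
  have carM: "carrier ?M = W.O0 \<times> W.O0" and addM: "x \<oplus>\<^bsub>?M\<^esub> y = x + y"
    and smultM: "c \<odot>\<^bsub>?M\<^esub> x = form_scale (const_xy c) x" and carR: "carrier ?R = ?S" for x y c
    by (simp_all add: O0 Omega1_def base_ring_def)
  have const: "const_xy c \<in> W.O0 \<and> dd (const_xy c) = 0" if "c \<in> ?S" for c
    using that by (auto simp: const_xy_def W.pCons_O0_iff pCons_in_polys_over_iff dd_def
        deriv_x_pCons deriv_x_0 deriv_y_def pderiv_pCons zero_prod_def intro: W.ringI)
  have subN: "submodule ?N ?R ?M"
  proof (rule M.submoduleI)
    show "?N \<subseteq> carrier ?M" unfolding N carM by (rule W.rel_subset)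
    have "form_scale W.f 0 \<in> W.rel" using W.ringI(13) by (intro W.rel_multiple) (simp add: zero_prod_def)
    then show "\<zero>\<^bsub>?M\<^esub> \<in> ?N" by (simp add: N form_scale_def Omega1_def zero_prod_def)
  next
    fix x assume x: "x \<in> ?N"
    then have xM: "x \<in> carrier ?M" using W.rel_subset unfolding N carM by blast
    have "form_scale (const_xy (- 1)) x \<in> W.rel"
      using x const[of "- 1"] ringS unfolding N by (intro W.rel_smult) (auto intro: is_subringD)
    moreover have "form_scale (const_xy (- 1)) x = - x"
      by (simp add: form_scale_def const_xy_hom prod_eq_iff)
    ultimately have neg: "- x \<in> ?N" by (simp add: N)
    then have "- x \<in> carrier ?M" using W.rel_subset unfolding N carM by blast
    then have "\<ominus>\<^bsub>?M\<^esub> x = - x"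
      using M.minus_equality[of "- x" x] xM by (simp add: addM) (simp add: Omega1_def)
    then show "\<ominus>\<^bsub>?M\<^esub> x \<in> ?N" using neg by simp
  next
    fix x y assume "x \<in> ?N" "y \<in> ?N"
    then show "x \<oplus>\<^bsub>?M\<^esub> y \<in> ?N" unfolding N addM by (rule W.rel_add)
  next
    fix c x assume "c \<in> carrier ?R" "x \<in> ?N"
    then show "c \<odot>\<^bsub>?M\<^esub> x \<in> ?N"
      unfolding N smultM carR using const by (intro W.rel_smult) auto
  qed

  note quot = modM subN
  let ?H = "quot_module ?M ?N" and ?cl = "\<lambda>\<eta>. ?N +>\<^bsub>?M\<^esub> \<eta>"
  let ?b = "\<lambda>i::nat. ?cl (if i = 1 then omega1 else omega2)"
  have modH: "module ?R ?H" by (rule module_quot_module[OF quot])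
  have omega: "omega1 \<in> carrier ?M" "omega2 \<in> carrier ?M"
    using W.omega_combination_in_forms[of 1 0] W.omega_combination_in_forms[of 0 1] is_subringD[OF ringS]
    unfolding carM by (simp_all add: form_scale_def const_xy_hom zero_prod_def[symmetric])
  have comb: "c \<odot>\<^bsub>?H\<^esub> ?cl omega1 \<oplus>\<^bsub>?H\<^esub> d \<odot>\<^bsub>?H\<^esub> ?cl omega2 =
      ?cl (form_scale (const_xy c) omega1 + form_scale (const_xy d) omega2)"
    if "c \<in> ?S" "d \<in> ?S" for c d
    using that omega M.smult_closed
    by (simp add: quot_module_smult[OF quot] quot_module_add[OF quot] carR addM smultM)
  have combM: "form_scale (const_xy c) omega1 + form_scale (const_xy d) omega2 \<in> carrier ?M"
    if "c \<in> ?S" "d \<in> ?S" for c d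
    using W.omega_combination_in_forms[OF that] by (simp add: carM)
  have basis: "module_basis ?R ?H {1, 2} ?b"
  proof (rule module_basis_pairI[OF modH])
    show "?b 1 \<in> carrier ?H" "?b 2 \<in> carrier ?H"
      unfolding quot_module_carrier[OF quot] using omega by (auto simp del: split_paired_Ex)
  next
    fix X assume "X \<in> carrier ?H"
    then obtain \<eta> where \<eta>: "\<eta> \<in> W.O0 \<times> W.O0" "X = ?cl \<eta>"
      unfolding quot_module_carrier[OF quot] carM by blast
    obtain c d where cd: "c \<in> ?S" "d \<in> ?S"
        "\<eta> - (form_scale (const_xy c) omega1 + form_scale (const_xy d) omega2) \<in> W.rel"
      using W.omega_span[OF w(1) w_unit \<eta>(1)] by auto
    have "X = ?cl (form_scale (const_xy c) omega1 + form_scale (const_xy d) omega2)"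
      unfolding \<eta>(2) using cd combM
      by (intro coset_eqI[OF quot, of _ "\<eta> - (form_scale (const_xy c) omega1 + form_scale (const_xy d) omega2)"])
        (simp_all add: addM N)
    then show "\<exists>c\<in>carrier ?R. \<exists>d\<in>carrier ?R. X = c \<odot>\<^bsub>?H\<^esub> ?b 1 \<oplus>\<^bsub>?H\<^esub> d \<odot>\<^bsub>?H\<^esub> ?b 2"
      using cd comb by (auto simp: carR)
  next
    fix c d
    assume cd: "c \<in> carrier ?R" "d \<in> carrier ?R"
      and zero: "c \<odot>\<^bsub>?H\<^esub> ?b 1 \<oplus>\<^bsub>?H\<^esub> d \<odot>\<^bsub>?H\<^esub> ?b 2 = \<zero>\<^bsub>?H\<^esub>"
    then have "?cl (form_scale (const_xy c) omega1 + form_scale (const_xy d) omega2) = ?N"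
      using comb by (simp add: carR quot_module_zero[OF quot])
    then have "form_scale (const_xy c) omega1 + form_scale (const_xy d) omega2 \<in> W.rel"
      using coset_eq_submodule_iff[OF quot combM] cd by (simp add: carR N)
    then show "c = \<zero>\<^bsub>?R\<^esub> \<and> d = \<zero>\<^bsub>?R\<^esub>"
      using W.omega_independent[OF w(1)] by (simp add: base_ring_def)
  qed simp
  moreover have "free_module ?R ?H"
    using modH basis by (rule module_basis_imp_free_module) (simp add: base_ring_def)
  ultimately show ?thesis unfolding Brieskorn_def Brieskorn_class_def by simp
qed

end
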